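(* Let $X$ be a complex normed space, let $k\ge 2$, and let $\mathcal{C}=\{P_1,P_2,\ldots,P_k\}$ be a finite collection of nonzero, pairwise distinct idempotent maps $P_i:X\to X$ (not assumed linear or continuous) which defines a partition of the identity by idempotents, i.e. $\sum_{i=1}^k P_i=I$. If $\mathcal{C}$ is a commuting partition of the identity by idempotents, i.e. $P_iP_j=P_jP_i$ for all $i\ne j$, then $\mathcal{C}$ is an orthogonal partition of the identity by idempotents, i.e. $P_iP_j=0$ for all $i\neq j$.
   Context: A map $P:X\to X$ is called idempotent if $P^2=P\circ P=P$; no linearity or continuity is assumed. Products of maps denote composition, sums and scalar multiples of maps are pointwise, $I$ is the identity map on $X$, and $0$ denotes the zero map. "Nonzero" means not equal to the zero map. *)

theory Defs
  imports Complex_Main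
begin

text \<open>
  The norm, metric and topology are inherited from the underlying real normed space;
  \<open>scaleR_scaleC\<close> makes the inherited real scaling the restriction of the complex one.
\<close>

class complex_normed_vector = real_normed_vector +
  fixes scaleC :: "complex \<Rightarrow> 'a \<Rightarrow> 'a" (infixr \<open>*\<^sub>C\<close> 75)
  assumes scaleC_add_right: "a *\<^sub>C (x + y) = a *\<^sub>C x + a *\<^sub>C y"
    and scaleC_add_left: "(a + b) *\<^sub>C x = a *\<^sub>C x + b *\<^sub>C x"
    and scaleC_scaleC: "a *\<^sub>C b *\<^sub>C x = (a * b) *\<^sub>C x"
    and scaleC_one: "1 *\<^sub>C x = x"
    and scaleR_scaleC: "r *\<^sub>R x = complex_of_real r *\<^sub>C x"
    and norm_scaleC: "norm (a *\<^sub>C x) = cmod a * norm x"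

instantiation complex :: complex_normed_vector
begin

definition scaleC_complex :: "complex \<Rightarrow> complex \<Rightarrow> complex" where
  "scaleC_complex a x = a * x"

instance
  by standard (simp_all add: scaleC_complex_def algebra_simps norm_mult scaleR_conv_of_real)

end

definition idempotent_map :: "('a \<Rightarrow> 'a) \<Rightarrow> bool" where
  "idempotent_map Q \<longleftrightarrow> Q \<circ> Q = Q"

definition idempotent_partition :: "nat \<Rightarrow> (nat \<Rightarrow> 'a \<Rightarrow> 'a::complex_normed_vector) \<Rightarrow> bool" where
  "idempotent_partition k P \<longleftrightarrow>
     (\<forall>i\<in>{1..k}. idempotent_map (P i)) \<and> (\<lambda>x. \<Sum>i=1..k. P i x) = id"

definition commuting_partition :: "nat \<Rightarrow> (nat \<Rightarrow> 'a \<Rightarrow> 'a::complex_normed_vector) \<Rightarrow> bool" where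
  "commuting_partition k P \<longleftrightarrow>
     idempotent_partition k P \<and>
     (\<forall>i\<in>{1..k}. \<forall>j\<in>{1..k}. i \<noteq> j \<longrightarrow> P i \<circ> P j = P j \<circ> P i)"

definition orthogonal_partition :: "nat \<Rightarrow> (nat \<Rightarrow> 'a \<Rightarrow> 'a::complex_normed_vector) \<Rightarrow> bool" where
  "orthogonal_partition k P \<longleftrightarrow>
     idempotent_partition k P \<and>
     (\<forall>i\<in>{1..k}. \<forall>j\<in>{1..k}. i \<noteq> j \<longrightarrow> P i \<circ> P j = (\<lambda>x. 0))"

end

theory Submission
  imports Defs
begin

text \<open>
  The idea is to study common fixed points rather than products of the maps. If \<open>x\<close> is fixed by
  every \<open>P i\<close> with \<open>i \<in> S\<close>, then for \<open>j \<notin> S\<close> the vector \<open>P j x\<close> is again fixed by these maps,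
  because they commute with \<open>P j\<close>, and it is fixed by \<open>P j\<close> too, because \<open>P j\<close> is idempotent.
  A downward induction on \<open>S\<close> may therefore assume that \<open>P j x = 0\<close> for all \<open>j \<notin> S\<close>; evaluating
  the partition of the identity at \<open>x\<close> then leaves \<open>card S\<close> copies of \<open>x\<close> on one side and \<open>x\<close>
  on the other, so \<open>x = 0\<close> as soon as \<open>S\<close> has at least two elements
  (lemma \<open>common_fixed_point_eq_0\<close>). Orthogonality follows because every value of
  \<open>P i \<circ> P j\<close> is fixed by both \<open>P i\<close> and \<open>P j\<close>.
\<close>

text \<open>
  The induction runs on the number of indices outside \<open>S\<close>: passing from \<open>x\<close> to \<open>P j x\<close> moves
  one more index into \<open>S\<close>. For \<open>S = A\<close> no index is left outside, and the counting argument says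
  that a sum of \<open>card A\<close> copies of \<open>x\<close> equals \<open>x\<close>.
\<close>
lemma common_fixed_point_eq_0:
  fixes P :: "'i \<Rightarrow> 'a \<Rightarrow> 'a::real_vector"
  assumes fin: "finite A"
    and idem: "\<And>i x. i \<in> A \<Longrightarrow> P i (P i x) = P i x"
    and comm: "\<And>i j x. i \<in> A \<Longrightarrow> j \<in> A \<Longrightarrow> P i (P j x) = P j (P i x)"
    and partition: "\<And>x. (\<Sum>i\<in>A. P i x) = x"
    and "S \<subseteq> A" and "2 \<le> card S" and "\<And>i. i \<in> S \<Longrightarrow> P i x = x"
  shows "x = 0"
  using assms(5-7)
proof (induction "card (A - S)" arbitrary: S x rule: less_induct)
  case less
  have finS: "finite S"
    using fin less.prems(1) by (rule finite_subset[rotated])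
  have outside: "P j x = 0" if j: "j \<in> A - S" for j
  proof (rule less.hyps[of "insert j S"])
    show "card (A - insert j S) < card (A - S)"
      using j fin by (intro psubset_card_mono) auto
    show "insert j S \<subseteq> A" "2 \<le> card (insert j S)"
      using j less.prems(1,2) finS by auto
    show "P i (P j x) = P j x" if "i \<in> insert j S" for i
      using that j idem comm[of i j x] less.prems(1,3) by auto
  qed
  have "x = (\<Sum>i\<in>S. P i x) + (\<Sum>i\<in>A - S. P i x)"
    using partition[of x] sum.subset_diff[OF less.prems(1) fin, of "\<lambda>i. P i x"]
    by (simp add: add.commute)
  also have "\<dots> = real (card S) *\<^sub>R x"
    using outside less.prems(3) by (simp add: sum_constant_scaleR)
  finally have "(real (card S) - 1) *\<^sub>R x = 0"
    by (simp add: scaleR_left_diff_distrib)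
  then show "x = 0"
    using less.prems(2) by simp
qed

theorem theoremA:
  fixes P :: "nat \<Rightarrow> 'a \<Rightarrow> 'a::complex_normed_vector" and k :: nat
  assumes "2 \<le> k"
    and "\<And>i. i \<in> {1..k} \<Longrightarrow> P i \<noteq> (\<lambda>x. 0)"
    and "inj_on P {1..k}"
    and "idempotent_partition k P"
    and "commuting_partition k P"
  shows "orthogonal_partition k P"
proof -
  have idem: "P i (P i x) = P i x" if "i \<in> {1..k}" for i x
    using assms(4) that
    by (auto simp: idempotent_partition_def idempotent_map_def fun_eq_iff)
  have comm: "P i (P j x) = P j (P i x)" if "i \<in> {1..k}" "j \<in> {1..k}" for i j x
    using assms(5) that
    by (cases "i = j") (auto simp: commuting_partition_def fun_eq_iff)
  have partition: "(\<Sum>i=1..k. P i x) = x" for x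
    using assms(4) by (simp add: idempotent_partition_def fun_eq_iff)
  have "P i (P j x) = 0" if ij: "i \<in> {1..k}" "j \<in> {1..k}" "i \<noteq> j" for i j x
  proof (rule common_fixed_point_eq_0[of "{1..k}" P "{i, j}"])
    show "P l (P i (P j x)) = P i (P j x)" if "l \<in> {i, j}" for l
      using that idem[OF ij(1)] idem[OF ij(2)] comm[OF ij(1,2)] by auto
  qed (use ij idem comm partition in auto)
  then show ?thesis
    using assms(4) by (auto simp: orthogonal_partition_def fun_eq_iff)
qed

end
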